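(* Let $\Gamma\subset\mathrm{PSL}(2,\mathbb{R})$ be a Fuchsian group. A set $F\subset\mathbb{H}^2$ is a fundamental domain for $\Gamma$ (in $\mathbb{H}^2$) if and only if $T^1F=\{(z,\xi)\in T^1\mathbb{H}^2: z\in F\}\subset T^1\mathbb{H}^2$ is a fundamental domain for $\Gamma$ (in $T^1\mathbb{H}^2$).
   Context: $\mathbb{H}^2=\{z=x+iy\in\mathbb{C}: y>0\}$ is the hyperbolic upper half plane with Riemannian metric $g_z(\xi,\eta)=\frac{\xi_1\eta_1+\xi_2\eta_2}{(\mathrm{Im}\, z)^2}$ for $\xi=(\xi_1,\xi_2),\eta=(\eta_1,\eta_2)\in T_z\mathbb{H}^2\cong\mathbb{C}$. Its unit tangent bundle is $T^1\mathbb{H}^2=\{(z,\xi): z\in\mathbb{H}^2,\ \xi\in T_z\mathbb{H}^2,\ \|\xi\|_z=g_z(\xi,\xi)^{1/2}=1\}$, with its usual topology (the one induced by the Sasaki metric, equivalently the subspace topology from $\mathbb{H}^2\times\mathbb{C}$). $\mathrm{PSL}(2,\mathbb{R})=\mathrm{SL}(2,\mathbb{R})/\{\pm E_2\}$, where $E_2$ is the $2\times2$ unit matrix; $[G]$ denotes the class of $G\in\mathrm{SL}(2,\mathbb{R})$, and $e$ denotes the unity of a group. A Fuchsian group is a discrete subgroup of $\mathrm{PSL}(2,\mathbb{R})$. Fundamental domain: if a group $G$ acts on a topological space $X$ by a (left) action $\rho:G\times X\to X$, a non-empty open set $F\subset X$ is a fundamental domain for $G$ (in $X$) if (a) $\bigcup_{g\in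 G}\rho(g,\overline{F})=X$, where $\overline F$ is the closure of $F$ in $X$ and $\rho(g,A)=\{\rho(g,x):x\in A\}$, and (b) $\rho(g,F)\cap F=\varnothing$ for all $g\in G\setminus\{e\}$. $\Gamma$ acts on $\mathbb{H}^2$ by Möbius transformations, $\left[\begin{pmatrix}a&b\\c&d\end{pmatrix}\right]$ acting by $z\mapsto\frac{az+b}{cz+d}$, and acts on $T^1\mathbb{H}^2$ by the derivative operators: $\left[\begin{pmatrix}a&b\\c&d\end{pmatrix}\right]$ acts by $(z,\xi)\mapsto\left(\frac{az+b}{cz+d},\frac{\xi}{(cz+d)^2}\right)$. Fundamental domains in $\mathbb{H}^2$ and in $T^1\mathbb{H}^2$ are meant with respect to these actions. *)

theory Defs
  imports "HOL-Analysis.Analysis" "HOL-Algebra.Group_Action"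
begin

section \<open>The topological group PSL(2,R) and Fuchsian groups\<close>

definition SL2R :: "(real^2^2) monoid" where
  "SL2R = \<lparr>carrier = {A. det A = 1}, mult = (**), one = mat 1\<rparr>"

definition PSL2R :: "(real^2^2) set monoid" where
  "PSL2R = SL2R Mod {mat 1, - mat 1}"

definition psl_class :: "real^2^2 \<Rightarrow> (real^2^2) set" where
  "psl_class A = {mat 1, - mat 1} #>\<^bsub>SL2R\<^esub> A"

definition quotient_topology :: "'a topology \<Rightarrow> ('a \<Rightarrow> 'b) \<Rightarrow> 'b topology" where
  "quotient_topology X f =
     topology (\<lambda>U. U \<subseteq> f ` topspace X \<and> openin X {x \<in> topspace X. f x \<in> U})"

definition PSL2R_topology :: "(real^2^2) set topology" where
  "PSL2R_topology = quotient_topology (top_of_set (carrier SL2R)) psl_class"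

definition fuchsian_group :: "(real^2^2) set set \<Rightarrow> bool" where
  "fuchsian_group \<Gamma> \<longleftrightarrow>
     subgroup \<Gamma> PSL2R \<and> subtopology PSL2R_topology \<Gamma> = discrete_topology \<Gamma>"


section \<open>Fundamental domains\<close>

text \<open>
  Intended for a left action \<open>\<rho>\<close> of \<open>G\<close> on \<open>topspace X\<close>. That the two actions below are such
  actions is shown at the end of this theory.
\<close>

definition fundamental_domain ::
    "('g, 'm) monoid_scheme \<Rightarrow> 'x topology \<Rightarrow> ('g \<Rightarrow> 'x \<Rightarrow> 'x) \<Rightarrow> 'x set \<Rightarrow> bool" where
  "fundamental_domain G X \<rho> F \<longleftrightarrow>
     F \<noteq> {} \<and> openin X F \<and>
     (\<Union>g\<in>carrier G. \<rho> g ` (X closure_of F)) = topspace X \<and>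
     (\<forall>g\<in>carrier G - {\<one>\<^bsub>G\<^esub>}. \<rho> g ` F \<inter> F = {})"


section \<open>The hyperbolic plane, its unit tangent bundle, and the two actions\<close>

definition hyperbolic_plane :: "complex set" where
  "hyperbolic_plane = {z. Im z > 0}"

definition hyperbolic_metric :: "complex \<Rightarrow> complex \<Rightarrow> complex \<Rightarrow> real" where
  "hyperbolic_metric z \<xi> \<eta> = (Re \<xi> * Re \<eta> + Im \<xi> * Im \<eta>) / (Im z)\<^sup>2"

definition hyperbolic_norm :: "complex \<Rightarrow> complex \<Rightarrow> real" where
  "hyperbolic_norm z \<xi> = sqrt (hyperbolic_metric z \<xi> \<xi>)"

definition unit_tangent_bundle :: "(complex \<times> complex) set" where
  "unit_tangent_bundle = {(z, \<xi>). z \<in> hyperbolic_plane \<and> hyperbolic_norm z \<xi> = 1}"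

definition unit_tangent_over :: "complex set \<Rightarrow> (complex \<times> complex) set" where
  "unit_tangent_over F = {(z, \<xi>). (z, \<xi>) \<in> unit_tangent_bundle \<and> z \<in> F}"

definition numer :: "real^2^2 \<Rightarrow> complex \<Rightarrow> complex" where
  "numer A z = of_real (A $ 1 $ 1) * z + of_real (A $ 1 $ 2)"

definition denom :: "real^2^2 \<Rightarrow> complex \<Rightarrow> complex" where
  "denom A z = of_real (A $ 2 $ 1) * z + of_real (A $ 2 $ 2)"

text \<open>
  An element of \<^const>\<open>PSL2R\<close> is a set of two matrices \<open>A\<close> and \<open>- A\<close>; it acts through an arbitrary
  representative. Independence of the choice is shown in \<open>psl_moebius_class\<close> and
  \<open>psl_derivative_class\<close>. The actions are made extensional to fit \<^locale>\<open>group_action\<close>.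
\<close>

definition psl_moebius :: "(real^2^2) set \<Rightarrow> complex \<Rightarrow> complex" where
  "psl_moebius g = (\<lambda>z\<in>hyperbolic_plane.
     let A = (SOME A. A \<in> g) in numer A z / denom A z)"

definition psl_derivative :: "(real^2^2) set \<Rightarrow> complex \<times> complex \<Rightarrow> complex \<times> complex" where
  "psl_derivative g = (\<lambda>(z, \<xi>)\<in>unit_tangent_bundle.
     let A = (SOME A. A \<in> g) in (numer A z / denom A z, \<xi> / (denom A z)\<^sup>2))"


section \<open>Well-definedness\<close>

lemma istopology_quotient:
  "istopology (\<lambda>U. U \<subseteq> f ` topspace X \<and> openin X {x \<in> topspace X. f x \<in> U})"
proof -
  have *: "{x \<in> topspace X. f x \<in> S \<inter> T} = {x \<in> topspace X. f x \<in> S} \<inter> {x \<in> topspace X. f x \<in> T}"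
    for S T by auto
  have **: "{x \<in> topspace X. f x \<in> \<Union>K} = (\<Union>U\<in>K. {x \<in> topspace X. f x \<in> U})" for K
    by auto
  show ?thesis
    unfolding istopology_def * ** by (auto intro!: openin_Int openin_Union)
qed

lemma openin_quotient_topology:
  "openin (quotient_topology X f) U \<longleftrightarrow>
     U \<subseteq> f ` topspace X \<and> openin X {x \<in> topspace X. f x \<in> U}"
  unfolding quotient_topology_def by (simp add: topology_inverse'[OF istopology_quotient])

lemma topspace_quotient_topology: "topspace (quotient_topology X f) = f ` topspace X"
proof -
  have "{x \<in> topspace X. f x \<in> f ` topspace X} = topspace X" by auto
  then have "openin (quotient_topology X f) (f ` topspace X)"
    by (simp add: openin_quotient_topology)
  then show ?thesis
    by (metis openin_quotient_topology openin_subset openin_topspace subset_antisym)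
qed

lemma quotient_map_quotient_topology: "quotient_map X (quotient_topology X f) f"
  unfolding quotient_map_def topspace_quotient_topology openin_quotient_topology by auto

lemma matrix_mult_minus:
  fixes A B :: "real^2^2"
  shows "(- A) ** B = - (A ** B)" "A ** (- B) = - (A ** B)"
  by (simp_all add: matrix_matrix_mult_def vec_eq_iff sum_negf)

lemma det_minus_2: "det (- A) = det (A :: real^2^2)"
  by (simp add: det_2)

lemma group_SL2R: "group SL2R"
proof (rule groupI)
  fix A assume "A \<in> carrier SL2R"
  then have "det A = 1" by (simp add: SL2R_def)
  then obtain B where B: "A ** B = mat 1" "B ** A = mat 1"
    using invertible_det_nz[of A] by (auto simp: invertible_def)
  then have "det B = 1"
    using \<open>det A = 1\<close> by (metis det_I det_mul mult_1)
  with B show "\<exists>B\<in>carrier SL2R. B \<otimes>\<^bsub>SL2R\<^esub> A = \<one>\<^bsub>SL2R\<^esub>"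
    by (auto simp: SL2R_def)
qed (auto simp: SL2R_def det_mul matrix_mul_assoc)

lemma psl_class_eq: "psl_class A = {A, - A}"
  by (auto simp: psl_class_def r_coset_def SL2R_def matrix_mult_minus)

lemma normal_pm1: "{mat 1, - mat 1} \<lhd> SL2R"
proof -
  interpret group SL2R by (rule group_SL2R)
  have "subgroup {mat 1, - mat 1} SL2R"
  proof (rule subgroupI)
    fix A assume A: "A \<in> {mat 1, - mat 1 :: real^2^2}"
    then have "inv\<^bsub>SL2R\<^esub> A = A"
      by (intro inv_equality) (auto simp: SL2R_def det_minus_2 matrix_mult_minus)
    with A show "inv\<^bsub>SL2R\<^esub> A \<in> {mat 1, - mat 1}" by simp
  qed (auto simp: SL2R_def det_minus_2 matrix_mult_minus)
  then show ?thesis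
    by (rule normalI)
      (auto simp: r_coset_def l_coset_def SL2R_def matrix_mult_minus)
qed

lemma group_PSL2R: "group PSL2R"
  unfolding PSL2R_def by (rule normal.factorgroup_is_group[OF normal_pm1])

lemma carrier_PSL2R: "carrier PSL2R = psl_class ` carrier SL2R"
  unfolding PSL2R_def carrier_FactGroup psl_class_def ..

lemma one_PSL2R: "\<one>\<^bsub>PSL2R\<^esub> = psl_class (mat 1)"
  unfolding PSL2R_def psl_class_eq by simp

lemma mult_PSL2R: "psl_class A \<otimes>\<^bsub>PSL2R\<^esub> psl_class B = psl_class (A ** B)"
  unfolding PSL2R_def psl_class_eq
  by (auto simp: set_mult_def SL2R_def matrix_mult_minus)

lemma numer_minus: "numer (- A) z = - numer A z" and denom_minus: "denom (- A) z = - denom A z"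
  by (simp_all add: numer_def denom_def)

lemma some_psl_class: "(SOME B. B \<in> psl_class A) = A \<or> (SOME B. B \<in> psl_class A) = - A"
  by (metis (mono_tags, lifting) empty_iff insertE insertI1 psl_class_eq someI)

lemma psl_moebius_class:
  assumes "z \<in> hyperbolic_plane"
  shows "psl_moebius (psl_class A) z = numer A z / denom A z"
  using some_psl_class[of A] assms
  by (auto simp: psl_moebius_def Let_def numer_minus denom_minus)

lemma psl_derivative_class:
  assumes "(z, \<xi>) \<in> unit_tangent_bundle"
  shows "psl_derivative (psl_class A) (z, \<xi>) = (numer A z / denom A z, \<xi> / (denom A z)\<^sup>2)"
  using some_psl_class[of A] assms
  by (auto simp: psl_derivative_def Let_def numer_minus denom_minus)

lemma denom_nonzero:
  assumes "A \<in> carrier SL2R" "z \<in> hyperbolic_plane"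
  shows "denom A z \<noteq> 0"
proof
  assume "denom A z = 0"
  then have "A $ 2 $ 1 * Im z = 0" "A $ 2 $ 1 * Re z + A $ 2 $ 2 = 0"
    by (auto simp: denom_def complex_eq_iff)
  with assms show False
    by (auto simp: SL2R_def det_2 hyperbolic_plane_def)
qed

lemma Im_moebius:
  assumes "A \<in> carrier SL2R" "z \<in> hyperbolic_plane"
  shows "Im (numer A z / denom A z) = Im z / (cmod (denom A z))\<^sup>2"
proof -
  have "Im (numer A z * cnj (denom A z)) = det A * Im z"
    by (simp add: numer_def denom_def det_2 algebra_simps)
  then show ?thesis
    using assms(1) by (simp add: SL2R_def Im_complex_div_eq_0 complex_div_cnj[of "numer A z"])
qed

lemma moebius_in:
  assumes "A \<in> carrier SL2R" "z \<in> hyperbolic_plane"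
  shows "numer A z / denom A z \<in> hyperbolic_plane"
  using Im_moebius[OF assms] denom_nonzero[OF assms] assms(2)
  by (simp add: hyperbolic_plane_def)

lemma hyperbolic_norm_eq:
  assumes "z \<in> hyperbolic_plane"
  shows "hyperbolic_norm z \<xi> = cmod \<xi> / Im z"
  using assms
  by (simp add: hyperbolic_norm_def hyperbolic_metric_def hyperbolic_plane_def cmod_def
      real_sqrt_divide power2_eq_square)

lemma derivative_in:
  assumes "A \<in> carrier SL2R" "(z, \<xi>) \<in> unit_tangent_bundle"
  shows "(numer A z / denom A z, \<xi> / (denom A z)\<^sup>2) \<in> unit_tangent_bundle"
proof -
  have z: "z \<in> hyperbolic_plane" and 1: "hyperbolic_norm z \<xi> = 1"
    using assms(2) by (auto simp: unit_tangent_bundle_def)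
  have "hyperbolic_norm (numer A z / denom A z) (\<xi> / (denom A z)\<^sup>2) = 1"
    using 1 denom_nonzero[OF assms(1) z]
    by (auto simp: hyperbolic_norm_eq[OF moebius_in[OF assms(1) z]] hyperbolic_norm_eq[OF z]
        Im_moebius[OF assms(1) z] norm_divide norm_power)
  then show ?thesis
    using moebius_in[OF assms(1) z] by (simp add: unit_tangent_bundle_def)
qed

lemma numer_denom_mult:
  assumes "denom B z \<noteq> 0"
  shows "numer (A ** B) z = numer A (numer B z / denom B z) * denom B z"
    and "denom (A ** B) z = denom A (numer B z / denom B z) * denom B z"
proof -
  have *: "(x * (n / d) + y) * d = x * n + y * d" if "d \<noteq> 0" for x y n d :: complex
    using that by (simp add: field_simps)
  show "numer (A ** B) z = numer A (numer B z / denom B z) * denom B z"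
    unfolding numer_def[of A] *[OF assms]
    by (simp add: numer_def denom_def matrix_matrix_mult_def sum_2 algebra_simps)
  show "denom (A ** B) z = denom A (numer B z / denom B z) * denom B z"
    unfolding denom_def[of A] *[OF assms]
    by (simp add: numer_def denom_def matrix_matrix_mult_def sum_2 algebra_simps)
qed

lemma group_actionI:
  assumes "group G"
    and closed: "\<And>g x. g \<in> carrier G \<Longrightarrow> x \<in> E \<Longrightarrow> \<rho> g x \<in> E"
    and ext: "\<And>g. g \<in> carrier G \<Longrightarrow> \<rho> g \<in> extensional E"
    and one: "\<And>x. x \<in> E \<Longrightarrow> \<rho> \<one>\<^bsub>G\<^esub> x = x"
    and mult: "\<And>g h x. g \<in> carrier G \<Longrightarrow> h \<in> carrier G \<Longrightarrow> x \<in> E \<Longrightarrow> \<rho> (g \<otimes>\<^bsub>G\<^esub> h) x = \<rho> g (\<rho> h x)"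
  shows "group_action G E \<rho>"
proof -
  interpret group G by fact
  have bij: "\<rho> g \<in> Bij E" if "g \<in> carrier G" for g
  proof -
    have "\<rho> g (\<rho> (inv\<^bsub>G\<^esub> g) x) = x" "\<rho> (inv\<^bsub>G\<^esub> g) (\<rho> g x) = x" if "x \<in> E" for x
      using that \<open>g \<in> carrier G\<close> mult[of g "inv\<^bsub>G\<^esub> g" x] mult[of "inv\<^bsub>G\<^esub> g" g x] one by simp_all
    then have "bij_betw (\<rho> g) E E"
      using closed that by (intro bij_betw_byWitness[where f' = "\<rho> (inv\<^bsub>G\<^esub> g)"]) auto
    then show ?thesis
      using ext that by (simp add: Bij_def)
  qed
  have "\<rho> (g \<otimes>\<^bsub>G\<^esub> h) = compose E (\<rho> g) (\<rho> h)" if "g \<in> carrier G" "h \<in> carrier G" for g h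
    using that by (intro extensionalityI[OF ext]) (auto simp: compose_eq mult)
  then have "\<rho> \<in> hom G (BijGroup E)"
    using bij by (auto simp: hom_def BijGroup_def)
  then show ?thesis
    by (simp add: group_action_def group_hom_def group_hom_axioms_def group_BijGroup \<open>group G\<close>)
qed

lemma group_action_psl_moebius: "group_action PSL2R hyperbolic_plane psl_moebius"
proof (rule group_actionI[OF group_PSL2R])
  fix g h z assume g: "g \<in> carrier PSL2R" and h: "h \<in> carrier PSL2R" and z: "z \<in> hyperbolic_plane"
  then obtain A B where AB: "A \<in> carrier SL2R" "g = psl_class A" "B \<in> carrier SL2R" "h = psl_class B"
    by (auto simp: carrier_PSL2R)
  then show "psl_moebius (g \<otimes>\<^bsub>PSL2R\<^esub> h) z = psl_moebius g (psl_moebius h z)"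
    using z denom_nonzero[OF AB(3) z]
    by (simp add: mult_PSL2R psl_moebius_class moebius_in numer_denom_mult)
next
  fix z assume "z \<in> hyperbolic_plane"
  then show "psl_moebius \<one>\<^bsub>PSL2R\<^esub> z = z"
    by (simp add: one_PSL2R psl_moebius_class numer_def denom_def mat_def)
qed (auto simp: carrier_PSL2R psl_moebius_class moebius_in, simp add: psl_moebius_def)

lemma group_action_psl_derivative: "group_action PSL2R unit_tangent_bundle psl_derivative"
proof (rule group_actionI[OF group_PSL2R])
  fix g h p
  assume g: "g \<in> carrier PSL2R" and h: "h \<in> carrier PSL2R" and p: "p \<in> unit_tangent_bundle"
  then obtain A B where AB: "A \<in> carrier SL2R" "g = psl_class A" "B \<in> carrier SL2R" "h = psl_class B"
    by (auto simp: carrier_PSL2R)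
  obtain z \<xi> where [simp]: "p = (z, \<xi>)" by fastforce
  have "z \<in> hyperbolic_plane" using p by (simp add: unit_tangent_bundle_def)
  then show "psl_derivative (g \<otimes>\<^bsub>PSL2R\<^esub> h) p = psl_derivative g (psl_derivative h p)"
    using p AB denom_nonzero[OF AB(3), of z]
    by (simp add: mult_PSL2R psl_derivative_class derivative_in numer_denom_mult
        power_mult_distrib mult.commute)
next
  fix p assume "p \<in> unit_tangent_bundle"
  then show "psl_derivative \<one>\<^bsub>PSL2R\<^esub> p = p"
    by (cases p) (simp add: one_PSL2R psl_derivative_class numer_def denom_def mat_def)
qed (auto simp: carrier_PSL2R psl_derivative_class derivative_in, simp add: psl_derivative_def)

end

theory Submission
  imports Defs
begin

text \<open>
  The base point projection from the unit tangent bundle to the hyperbolic plane is continuous,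
  open, surjective and equivariant. Preimages under such a map commute with closures and with the
  group action, and taking preimages is injective, so each clause in the definition of a
  fundamental domain holds for a set iff it holds for its preimage.
\<close>

lemma closure_of_preimage_open_map:
  assumes "continuous_map X Y p" "open_map X Y p"
  shows "X closure_of {x \<in> topspace X. p x \<in> A} = {x \<in> topspace X. p x \<in> Y closure_of A}"
proof (intro equalityI subsetI)
  fix x assume x: "x \<in> X closure_of {x \<in> topspace X. p x \<in> A}"
  have "p ` {x \<in> topspace X. p x \<in> A} \<subseteq> A" by auto
  then have "p ` (X closure_of {x \<in> topspace X. p x \<in> A}) \<subseteq> Y closure_of A"
    by (rule order_trans[OF continuous_map_image_closure_subset[OF assms(1)] closure_of_mono])
  then have "p x \<in> Y closure_of A"
    using x by (rule subsetD[OF _ imageI])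
  moreover have "x \<in> topspace X"
    using x by (simp add: in_closure_of)
  ultimately show "x \<in> {x \<in> topspace X. p x \<in> Y closure_of A}"
    by simp
next
  fix x assume x: "x \<in> {x \<in> topspace X. p x \<in> Y closure_of A}"
  have "\<exists>y. y \<in> {x \<in> topspace X. p x \<in> A} \<and> y \<in> U" if "x \<in> U" "openin X U" for U
  proof -
    have "openin Y (p ` U)" "p x \<in> p ` U"
      using assms(2) that by (auto simp: open_map_def)
    then obtain y where "y \<in> U" "p y \<in> A"
      using x by (auto simp: in_closure_of)
    then show ?thesis
      using openin_subset[OF \<open>openin X U\<close>] by auto
  qed
  then show "x \<in> X closure_of {x \<in> topspace X. p x \<in> A}"
    using x by (auto simp: in_closure_of)
qed

lemma fundamental_domain_preimage_iff:
  assumes cont: "continuous_map X Y p" and op: "open_map X Y p"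
    and surj: "p ` topspace X = topspace Y"
    and bij_X: "\<And>g. g \<in> carrier G \<Longrightarrow> bij_betw (\<rho> g) (topspace X) (topspace X)"
    and bij_Y: "\<And>g. g \<in> carrier G \<Longrightarrow> bij_betw (\<sigma> g) (topspace Y) (topspace Y)"
    and equivariant: "\<And>g x. g \<in> carrier G \<Longrightarrow> x \<in> topspace X \<Longrightarrow> p (\<rho> g x) = \<sigma> g (p x)"
    and F: "F \<subseteq> topspace Y"
  shows "fundamental_domain G X \<rho> {x \<in> topspace X. p x \<in> F} \<longleftrightarrow> fundamental_domain G Y \<sigma> F"
proof -
  define P where "P A = {x \<in> topspace X. p x \<in> A}" for A
  \<comment> \<open>By surjectivity, taking images under \<open>p\<close> inverts \<open>P\<close>
    on subsets of \<open>topspace Y\<close>.\<close>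
  have P_eq_iff: "P A = P B \<longleftrightarrow> A = B" if "A \<subseteq> topspace Y" "B \<subseteq> topspace Y" for A B
  proof -
    have "p ` P A = A" if "A \<subseteq> topspace Y" for A
      using that surj by (auto simp: P_def image_iff subset_iff)
    then show ?thesis using that by metis
  qed
  \<comment> \<open>Only the inclusion from right to left needs bijectivity: surjectivity of
    \<open>\<rho> g\<close> writes \<open>y\<close> as \<open>\<rho> g x\<close>, and injectivity of
    \<open>\<sigma> g\<close> then puts \<open>p x\<close> itself into \<open>A\<close>.\<close>
  have image_P: "\<rho> g ` P A = P (\<sigma> g ` A)" if g: "g \<in> carrier G" and A: "A \<subseteq> topspace Y" for g A
  proof (intro equalityI subsetI)
    fix y assume "y \<in> \<rho> g ` P A"
    then show "y \<in> P (\<sigma> g ` A)"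
      using bij_betw_imp_surj_on[OF bij_X[OF g]] equivariant[OF g] by (auto simp: P_def)
  next
    fix y assume y: "y \<in> P (\<sigma> g ` A)"
    then obtain x where x: "x \<in> topspace X" "y = \<rho> g x"
      using bij_betw_imp_surj_on[OF bij_X[OF g]] by (auto simp: P_def)
    then obtain a where "a \<in> A" "\<sigma> g (p x) = \<sigma> g a"
      using y equivariant[OF g] by (auto simp: P_def)
    moreover have "p x \<in> topspace Y" using x surj by auto
    ultimately have "p x \<in> A"
      using A bij_betw_imp_inj_on[OF bij_Y[OF g]] by (metis inj_onD subsetD)
    then show "y \<in> \<rho> g ` P A" using x by (auto simp: P_def)
  qed
  have image_sub: "\<sigma> g ` A \<subseteq> topspace Y" if "g \<in> carrier G" "A \<subseteq> topspace Y" for g A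
    using bij_betw_imp_surj_on[OF bij_Y] that by blast
  have "P F \<noteq> {} \<longleftrightarrow> F \<noteq> {}"
    using P_eq_iff[OF F, of "{}"] by (simp add: P_def)
  \<comment> \<open>A continuous open surjection is a quotient map, which gives both
    directions.\<close>
  moreover have "openin X (P F) \<longleftrightarrow> openin Y F"
    using continuous_open_imp_quotient_map[OF cont op surj] F
    by (simp add: quotient_map_def P_def)
  moreover have "(\<Union>g\<in>carrier G. \<rho> g ` (X closure_of P F)) = topspace X \<longleftrightarrow>
      (\<Union>g\<in>carrier G. \<sigma> g ` (Y closure_of F)) = topspace Y"
  proof -
    have "X closure_of P F = P (Y closure_of F)"
      unfolding P_def by (rule closure_of_preimage_open_map[OF cont op])
    then have "(\<Union>g\<in>carrier G. \<rho> g ` (X closure_of P F)) =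
        (\<Union>g\<in>carrier G. P (\<sigma> g ` (Y closure_of F)))"
      by (simp add: image_P closure_of_subset_topspace)
    also have "\<dots> = P (\<Union>g\<in>carrier G. \<sigma> g ` (Y closure_of F))"
      by (auto simp: P_def)
    finally have "(\<Union>g\<in>carrier G. \<rho> g ` (X closure_of P F)) =
        P (\<Union>g\<in>carrier G. \<sigma> g ` (Y closure_of F))" .
    moreover have "topspace X = P (topspace Y)"
      using surj by (auto simp: P_def)
    ultimately show ?thesis
      using image_sub[OF _ closure_of_subset_topspace] by (simp add: P_eq_iff UN_least)
  qed
  \<comment> \<open>\<open>P\<close> commutes with intersections, and \<open>P B\<close> is empty
    only for empty \<open>B\<close> by \<open>P_eq_iff\<close>.\<close>
  moreover have "\<rho> g ` P F \<inter> P F = {} \<longleftrightarrow> \<sigma> g ` F \<inter> F = {}" if "g \<in> carrier G" for g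
  proof -
    have "\<rho> g ` P F \<inter> P F = P (\<sigma> g ` F \<inter> F)"
      using image_P[OF that F] by (auto simp: P_def)
    then show ?thesis
      using P_eq_iff[of "\<sigma> g ` F \<inter> F" "{}"] F by (auto simp: P_def)
  qed
  ultimately show ?thesis
    unfolding fundamental_domain_def P_def[symmetric] by simp
qed

text \<open>The hyperbolic norm at \<open>z\<close> is the Euclidean norm divided by
  \<open>Im z\<close>, so each fibre is a Euclidean circle. Two fibres thus differ only by a
  scaling, which the sections below exploit.\<close>

lemma mem_unit_tangent_bundle_iff:
  "(z, \<xi>) \<in> unit_tangent_bundle \<longleftrightarrow> z \<in> hyperbolic_plane \<and> cmod \<xi> = Im z"
  by (auto simp: unit_tangent_bundle_def hyperbolic_norm_eq)
    (auto simp: hyperbolic_plane_def)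

lemma fst_image_unit_tangent_bundle: "fst ` unit_tangent_bundle = hyperbolic_plane"
proof (intro equalityI subsetI)
  fix z assume "z \<in> hyperbolic_plane"
  \<comment> \<open>The horizontal vector of Euclidean length \<open>Im z\<close> serves as a unit
    tangent vector at \<open>z\<close>.\<close>
  then have "(z, of_real (Im z)) \<in> unit_tangent_bundle"
    by (simp add: mem_unit_tangent_bundle_iff) (simp add: hyperbolic_plane_def)
  then show "z \<in> fst ` unit_tangent_bundle" by force
qed (auto simp: mem_unit_tangent_bundle_iff)

lemma continuous_map_fst_unit_tangent_bundle:
  "continuous_map (top_of_set unit_tangent_bundle) (top_of_set hyperbolic_plane) fst"
  by (auto simp: mem_unit_tangent_bundle_iff intro!: continuous_intros)

text \<open>Through every unit tangent vector passes a global continuous section, namely its rescaling.\<close>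
lemma open_map_fst_unit_tangent_bundle:
  "open_map (top_of_set unit_tangent_bundle) (top_of_set hyperbolic_plane) fst"
  unfolding open_map_def
proof (intro allI impI)
  fix U assume U: "openin (top_of_set unit_tangent_bundle) U"
  \<comment> \<open>\<open>s (w, \<eta>)\<close> keeps the direction of \<open>\<eta>\<close> and
    changes its Euclidean length from \<open>Im w\<close> to \<open>Im z\<close>. At
    \<open>z = w\<close> it returns \<open>(w, \<eta>)\<close>.\<close>
  define s where "s = (\<lambda>(w, \<eta>) z. (z :: complex, \<eta> * of_real (Im z / Im w) :: complex))"
  have s: "continuous_map (top_of_set hyperbolic_plane) (top_of_set unit_tangent_bundle) (s p)"
    and sp: "s p (fst p) = p" if "p \<in> unit_tangent_bundle" for p
  proof -
    obtain w \<eta> where p: "p = (w, \<eta>)" by fastforce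
    then have w: "Im w > 0" "cmod \<eta> = Im w"
      using that by (auto simp: mem_unit_tangent_bundle_iff hyperbolic_plane_def)
    then show "s p (fst p) = p"
      by (simp add: p s_def)
    have "continuous_on hyperbolic_plane (s p)"
      using w unfolding p s_def by (auto intro!: continuous_intros)
    moreover have "s p z \<in> unit_tangent_bundle" if "z \<in> hyperbolic_plane" for z
      using that w unfolding p s_def
      by (simp add: mem_unit_tangent_bundle_iff norm_mult norm_divide) (simp add: hyperbolic_plane_def)
    ultimately show "continuous_map (top_of_set hyperbolic_plane) (top_of_set unit_tangent_bundle) (s p)"
      by auto
  qed
  have U_sub: "U \<subseteq> unit_tangent_bundle"
    using openin_imp_subset[OF U] .
  have fst_s: "fst (s p z) = z" for p z
    by (simp add: s_def split: prod.split)
  \<comment> \<open>Each \<open>z = fst p\<close> with \<open>p\<close> in \<open>U\<close> lies in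
    the set indexed by \<open>p\<close>, since \<open>s p z = p\<close>. Conversely,
    \<open>s p z\<close> always has base point \<open>z\<close>. Continuity of the sections makes
    every set of this union open.\<close>
  have "fst ` U = (\<Union>p\<in>U. {z \<in> hyperbolic_plane. s p z \<in> U})"
  proof (intro equalityI subsetI)
    fix z assume "z \<in> fst ` U"
    then obtain p where "p \<in> U" "z = fst p" by blast
    then show "z \<in> (\<Union>p\<in>U. {z \<in> hyperbolic_plane. s p z \<in> U})"
      using sp[of p] U_sub fst_image_unit_tangent_bundle by (intro UN_I[of p]) auto
  next
    fix z assume "z \<in> (\<Union>p\<in>U. {z \<in> hyperbolic_plane. s p z \<in> U})"
    then obtain p where "s p z \<in> U" by blast
    then show "z \<in> fst ` U" using fst_s[of p z] by (metis imageI)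
  qed
  moreover have "openin (top_of_set hyperbolic_plane) {z \<in> hyperbolic_plane. s p z \<in> U}" if "p \<in> U" for p
    using openin_continuous_map_preimage[OF s[OF subsetD[OF U_sub that]] U] by simp
  ultimately show "openin (top_of_set hyperbolic_plane) (fst ` U)"
    by auto
qed

text \<open>This is the equivariance of the base point projection. Writing \<open>g\<close> as the
  class of one matrix evaluates both actions with the same representative.\<close>

lemma fst_psl_derivative:
  assumes "g \<in> carrier PSL2R" "p \<in> unit_tangent_bundle"
  shows "fst (psl_derivative g p) = psl_moebius g (fst p)"
  using assms by (cases p)
    (auto simp: carrier_PSL2R psl_derivative_class psl_moebius_class mem_unit_tangent_bundle_iff)

lemma (in group_action) bij_betw_action:
  assumes "g \<in> carrier G"
  shows "bij_betw (\<phi> g) E E"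
  using assms by (simp add: bij_betw_def inj_prop surj_prop)

theorem theorem3p2:
  fixes \<Gamma> :: "(real^2^2) set set" and F :: "complex set"
  assumes "fuchsian_group \<Gamma>" and "F \<subseteq> hyperbolic_plane"
  shows "fundamental_domain (PSL2R\<lparr>carrier := \<Gamma>\<rparr>) (top_of_set hyperbolic_plane) psl_moebius F
     \<longleftrightarrow> fundamental_domain (PSL2R\<lparr>carrier := \<Gamma>\<rparr>) (top_of_set unit_tangent_bundle) psl_derivative
           (unit_tangent_over F)"
proof -
  have \<Gamma>: "g \<in> carrier PSL2R" if "g \<in> \<Gamma>" for g
    using assms(1) that by (auto simp: fuchsian_group_def dest: subgroup.mem_carrier)
  have "unit_tangent_over F = {p \<in> topspace (top_of_set unit_tangent_bundle). fst p \<in> F}"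
    by (auto simp: unit_tangent_over_def)
  \<comment> \<open>Elements of \<Gamma> act as elements of \<open>PSL2R\<close>, so bijectivity and
    equivariance are inherited from the actions of the full group.\<close>
  moreover have "fundamental_domain (PSL2R\<lparr>carrier := \<Gamma>\<rparr>) (top_of_set unit_tangent_bundle)
      psl_derivative {p \<in> topspace (top_of_set unit_tangent_bundle). fst p \<in> F} \<longleftrightarrow>
    fundamental_domain (PSL2R\<lparr>carrier := \<Gamma>\<rparr>) (top_of_set hyperbolic_plane) psl_moebius F"
    using assms(2) \<Gamma>
    by (intro fundamental_domain_preimage_iff continuous_map_fst_unit_tangent_bundle
        open_map_fst_unit_tangent_bundle)
      (auto simp: fst_image_unit_tangent_bundle fst_psl_derivative
        group_action.bij_betw_action[OF group_action_psl_moebius]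
        group_action.bij_betw_action[OF group_action_psl_derivative])
  ultimately show ?thesis
    by simp
qed

end
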